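(* Let $(\mathbb{X},\perp)$ be a finitely disjoint $\perp$-restriction category, and let $\circledast$ be a family of operators assigning to each pair $f:X\to X$, $g:X\to A$ with $f\perp g$ a map $f\circledast g:X\to A$. Then $\circledast$ is a Kleene wand if and only if it satisfies axioms (1), (2), (3) of a Kleene wand together with: (4.a) for maps $f:X\to X$, $f':X\to X$, $g:X\to A$, if $f\perp f'$, $f\perp g$, and $f'\perp g$, then $$(f\sqcup f')\circledast g=(f\circledast f')\circledast(f\circledast g)$$ (the right-hand side being defined, i.e. $(f\circledast f')\perp(f\circledast g)$, as a consequence of (2)).
   Context: Composition is diagrammatic: $fg$ means first $f$, then $g$. A restriction category is a category with an operator sending each $f:A\to B$ to $\overline{f}:A\to A$ such that $\overline{f}f=f$; $\overline{f}\,\overline{g}=\overline{g}\,\overline{f}$ and $\overline{\overline{g}f}=\overline{g}\,\overline{f}$ for $f:A\to B$, $g:A\to C$; and $f\overline{g}=\overline{fg}f$ for $f:A\to B$, $g:B\to C$. For parallel $f,g$: $f\le g$ iff $\overline{f}g=f$ (a partial order). Restriction zeroes: maps $0:A\to B$ with $f0=0=0f$ and $\overline{0}=0$. An interference relation $\perp$ on a restriction category with restriction zeroes is a family of relations between maps with the same domain such that: $1_A\perp 0$; $f\perp g\Rightarrow g\perp f$; $f\perp f\Rightarrow f=0$; $f'\perp g'$, $f\le f'$, $g\le g'$ imply $f\perp g$; $f\perp g\Rightarrow hfk\perp hgk'$ for all composable $h,k,k'$; $f\perp g\Rightarrow\overline{f}\perp\overline{g}$. A $\perp$-restriction category is a restriction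 category with restriction zeroes and a chosen interference relation $\perp$. The $\perp$-join $\bigsqcup_if_i$ of a family of parallel maps with $f_i\perp f_j$ for $i\ne j$ is their least upper bound for $\le$; it is strong if $f_i\perp h$ for all $i$ implies $\bigsqcup_if_i\perp h$. A finitely disjoint $\perp$-restriction category is one in which every finite pairwise $\perp$-disjoint family of parallel maps has a $\perp$-join, $h\bigsqcup_if_i=\bigsqcup_ihf_i$ for all composable $h$, and every finite $\perp$-join is strong. A Kleene wand $\circledast$ on a $\perp$-restriction category with all binary $\perp$-joins assigns to each $f:X\to X$, $g:X\to A$ with $f\perp g$ a map $f\circledast g:X\to A$ such that: (1) if $f \perp g$, then $g\sqcup f(f\circledast g)=f\circledast g$; (2) $(f\circledast g)h=f\circledast gh$ for $f\perp g$, $h:A\to B$; (3) for $f:X\to Y$, $g:X\to A$, $k:Y\to X$ with $f\perp g$: $kf\circledast kg=k(fk\circledast g)$; (4) for $f,f':X\to X$, $g:X\to A$ with $f\perp f'$ and $f\sqcup f'\perp g$: $(f\circledast f')\perp(f\circledast g)$ and $(f\sqcup f')\circledast g=(f\circledast f')\circledast(f\circledast g)$. *)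

theory Defs
  imports Main
begin

text \<open>
  Composition is diagrammatic: \<open>f \<Zcomp> g\<close> means first \<open>f\<close>, then \<open>g\<close>.
  Operations are total functions on the arrow type; they are only constrained on arrows
  of the category, and composition only on composable pairs.
\<close>

record ('o, 'm) category_data =
  obj  :: "'o set"
  arr  :: "'m set"
  src  :: "'m \<Rightarrow> 'o"
  tgt  :: "'m \<Rightarrow> 'o"
  idm  :: "'o \<Rightarrow> 'm"
  cmp  :: "'m \<Rightarrow> 'm \<Rightarrow> 'm" (infixl "\<Zcomp>\<index>" 70)

definition hom :: "('o, 'm, 'x) category_data_scheme \<Rightarrow> 'o \<Rightarrow> 'o \<Rightarrow> 'm set" where
  "hom C A B = {f \<in> arr C. src C f = A \<and> tgt C f = B}"

locale category =
  fixes C :: "('o, 'm, 'x) category_data_scheme" (structure)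
  assumes src_obj: "f \<in> arr C \<Longrightarrow> src C f \<in> obj C"
    and tgt_obj: "f \<in> arr C \<Longrightarrow> tgt C f \<in> obj C"
    and idm_hom: "A \<in> obj C \<Longrightarrow> idm C A \<in> hom C A A"
    and cmp_hom: "f \<in> hom C A B \<Longrightarrow> g \<in> hom C B D \<Longrightarrow> f \<Zcomp> g \<in> hom C A D"
    and idm_left: "f \<in> hom C A B \<Longrightarrow> idm C A \<Zcomp> f = f"
    and idm_right: "f \<in> hom C A B \<Longrightarrow> f \<Zcomp> idm C B = f"
    and cmp_assoc: "f \<in> hom C A B \<Longrightarrow> g \<in> hom C B D \<Longrightarrow> h \<in> hom C D E
      \<Longrightarrow> (f \<Zcomp> g) \<Zcomp> h = f \<Zcomp> (g \<Zcomp> h)"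

record ('o, 'm) restriction_data = "('o, 'm) category_data" +
  rst :: "'m \<Rightarrow> 'm"

locale restriction_category = category C
  for C :: "('o, 'm, 'x) restriction_data_scheme" (structure) +
  assumes rst_hom: "f \<in> hom C A B \<Longrightarrow> rst C f \<in> hom C A A"
    and rst_cmp_self: "f \<in> hom C A B \<Longrightarrow> rst C f \<Zcomp> f = f"
    and rst_commute: "f \<in> hom C A B \<Longrightarrow> g \<in> hom C A D
      \<Longrightarrow> rst C f \<Zcomp> rst C g = rst C g \<Zcomp> rst C f"
    and rst_rst_cmp: "f \<in> hom C A B \<Longrightarrow> g \<in> hom C A D
      \<Longrightarrow> rst C (rst C g \<Zcomp> f) = rst C g \<Zcomp> rst C f"
    and cmp_rst: "f \<in> hom C A B \<Longrightarrow> g \<in> hom C B D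
      \<Longrightarrow> f \<Zcomp> rst C g = rst C (f \<Zcomp> g) \<Zcomp> f"

definition rle :: "('o, 'm, 'x) restriction_data_scheme \<Rightarrow> 'm \<Rightarrow> 'm \<Rightarrow> bool"
    (infix "\<sqsubseteq>\<index>" 50) where
  "f \<sqsubseteq>\<^bsub>C\<^esub> g \<longleftrightarrow> f \<in> arr C \<and> g \<in> arr C \<and> src C f = src C g \<and> tgt C f = tgt C g
     \<and> rst C f \<Zcomp>\<^bsub>C\<^esub> g = f"

text \<open>\<open>zro C A B\<close> is the restriction zero from \<open>A\<close> to \<open>B\<close>.\<close>

record ('o, 'm) restriction_zero_data = "('o, 'm) restriction_data" +
  zro :: "'o \<Rightarrow> 'o \<Rightarrow> 'm"

locale restriction_zero_category = restriction_category C
  for C :: "('o, 'm, 'x) restriction_zero_data_scheme" (structure) +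
  assumes zro_hom: "A \<in> obj C \<Longrightarrow> B \<in> obj C \<Longrightarrow> zro C A B \<in> hom C A B"
    and cmp_zro: "f \<in> hom C A B \<Longrightarrow> D \<in> obj C \<Longrightarrow> f \<Zcomp> zro C B D = zro C A D"
    and zro_cmp: "A \<in> obj C \<Longrightarrow> f \<in> hom C B D \<Longrightarrow> zro C A B \<Zcomp> f = zro C A D"
    and rst_zro: "A \<in> obj C \<Longrightarrow> B \<in> obj C \<Longrightarrow> rst C (zro C A B) = zro C A A"

record ('o, 'm) perp_data = "('o, 'm) restriction_zero_data" +
  perp :: "'m \<Rightarrow> 'm \<Rightarrow> bool" (infix "\<perp>\<index>" 50)

locale perp_restriction_category = restriction_zero_category C
  for C :: "('o, 'm, 'x) perp_data_scheme" (structure) +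
  assumes perp_same_src: "f \<perp> g \<Longrightarrow> f \<in> arr C \<and> g \<in> arr C \<and> src C f = src C g"
    and perp_idm_zro: "A \<in> obj C \<Longrightarrow> B \<in> obj C \<Longrightarrow> idm C A \<perp> zro C A B"
    and perp_sym: "f \<perp> g \<Longrightarrow> g \<perp> f"
    and perp_self: "f \<perp> f \<Longrightarrow> f = zro C (src C f) (tgt C f)"
    and perp_down: "f' \<perp> g' \<Longrightarrow> f \<sqsubseteq> f' \<Longrightarrow> g \<sqsubseteq> g' \<Longrightarrow> f \<perp> g"
    and perp_cmp: "f \<perp> g \<Longrightarrow> f \<in> hom C A B \<Longrightarrow> g \<in> hom C A D
      \<Longrightarrow> h \<in> hom C Z A \<Longrightarrow> k \<in> hom C B B' \<Longrightarrow> k' \<in> hom C D D'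
      \<Longrightarrow> h \<Zcomp> f \<Zcomp> k \<perp> h \<Zcomp> g \<Zcomp> k'"
    and perp_rst: "f \<perp> g \<Longrightarrow> rst C f \<perp> rst C g"

text \<open>
  Finite families of parallel maps are given by lists, indexed by position. The empty family
  is allowed, which is why the hom-set in which the join is taken is an explicit argument.
\<close>

definition perp_family ::
    "('o, 'm, 'x) perp_data_scheme \<Rightarrow> 'o \<Rightarrow> 'o \<Rightarrow> 'm list \<Rightarrow> bool" where
  "perp_family C A B fs \<longleftrightarrow> A \<in> obj C \<and> B \<in> obj C \<and> set fs \<subseteq> hom C A B
     \<and> (\<forall>i<length fs. \<forall>j<length fs. i \<noteq> j \<longrightarrow> fs ! i \<perp>\<^bsub>C\<^esub> fs ! j)"

definition is_perp_join ::
    "('o, 'm, 'x) perp_data_scheme \<Rightarrow> 'o \<Rightarrow> 'o \<Rightarrow> 'm list \<Rightarrow> 'm \<Rightarrow> bool" where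
  "is_perp_join C A B fs s \<longleftrightarrow> perp_family C A B fs \<and> s \<in> hom C A B
     \<and> (\<forall>f\<in>set fs. f \<sqsubseteq>\<^bsub>C\<^esub> s)
     \<and> (\<forall>u\<in>hom C A B. (\<forall>f\<in>set fs. f \<sqsubseteq>\<^bsub>C\<^esub> u) \<longrightarrow> s \<sqsubseteq>\<^bsub>C\<^esub> u)"

definition perp_join ::
    "('o, 'm, 'x) perp_data_scheme \<Rightarrow> 'o \<Rightarrow> 'o \<Rightarrow> 'm list \<Rightarrow> 'm" where
  "perp_join C A B fs = (THE s. is_perp_join C A B fs s)"

definition bjoin :: "('o, 'm, 'x) perp_data_scheme \<Rightarrow> 'm \<Rightarrow> 'm \<Rightarrow> 'm"
    (infixl "\<squnion>\<index>" 65) where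
  "f \<squnion>\<^bsub>C\<^esub> g = perp_join C (src C f) (tgt C f) [f, g]"

definition strong_perp_join ::
    "('o, 'm, 'x) perp_data_scheme \<Rightarrow> 'o \<Rightarrow> 'o \<Rightarrow> 'm list \<Rightarrow> 'm \<Rightarrow> bool" where
  "strong_perp_join C A B fs s \<longleftrightarrow> is_perp_join C A B fs s
     \<and> (\<forall>h\<in>arr C. src C h = A \<longrightarrow> (\<forall>f\<in>set fs. f \<perp>\<^bsub>C\<^esub> h) \<longrightarrow> s \<perp>\<^bsub>C\<^esub> h)"

locale finitely_disjoint_category = perp_restriction_category C
  for C :: "('o, 'm, 'x) perp_data_scheme" (structure) +
  assumes perp_join_exists: "perp_family C A B fs \<Longrightarrow> \<exists>s. is_perp_join C A B fs s"
    and cmp_perp_join: "perp_family C A B fs \<Longrightarrow> h \<in> hom C Z A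
      \<Longrightarrow> h \<Zcomp> perp_join C A B fs = perp_join C Z B (map (\<lambda>f. h \<Zcomp> f) fs)"
    and perp_join_strong: "is_perp_join C A B fs s \<Longrightarrow> strong_perp_join C A B fs s"

locale binary_perp_join_category = perp_restriction_category C
  for C :: "('o, 'm, 'x) perp_data_scheme" (structure) +
  assumes binary_perp_join_exists:
    "f \<in> hom C A B \<Longrightarrow> g \<in> hom C A B \<Longrightarrow> f \<perp> g \<Longrightarrow> \<exists>s. is_perp_join C A B [f, g] s"

text \<open>A wand \<open>w\<close> is a total function of which only the values at \<open>f : X \<rightarrow> X\<close>,
  \<open>g : X \<rightarrow> A\<close> with \<open>f \<perp> g\<close> are meaningful.\<close>

definition wand_operator ::
    "('o, 'm, 'x) perp_data_scheme \<Rightarrow> ('m \<Rightarrow> 'm \<Rightarrow> 'm) \<Rightarrow> bool" where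
  "wand_operator C w \<longleftrightarrow>
     (\<forall>X A. \<forall>f\<in>hom C X X. \<forall>g\<in>hom C X A. f \<perp>\<^bsub>C\<^esub> g \<longrightarrow> w f g \<in> hom C X A)"

definition wand_ax1 ::
    "('o, 'm, 'x) perp_data_scheme \<Rightarrow> ('m \<Rightarrow> 'm \<Rightarrow> 'm) \<Rightarrow> bool" where
  "wand_ax1 C w \<longleftrightarrow>
     (\<forall>X A. \<forall>f\<in>hom C X X. \<forall>g\<in>hom C X A.
        f \<perp>\<^bsub>C\<^esub> g \<longrightarrow> g \<squnion>\<^bsub>C\<^esub> (f \<Zcomp>\<^bsub>C\<^esub> w f g) = w f g)"

definition wand_ax2 ::
    "('o, 'm, 'x) perp_data_scheme \<Rightarrow> ('m \<Rightarrow> 'm \<Rightarrow> 'm) \<Rightarrow> bool" where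
  "wand_ax2 C w \<longleftrightarrow>
     (\<forall>X A B. \<forall>f\<in>hom C X X. \<forall>g\<in>hom C X A. \<forall>h\<in>hom C A B.
        f \<perp>\<^bsub>C\<^esub> g \<longrightarrow> w f g \<Zcomp>\<^bsub>C\<^esub> h = w f (g \<Zcomp>\<^bsub>C\<^esub> h))"

definition wand_ax3 ::
    "('o, 'm, 'x) perp_data_scheme \<Rightarrow> ('m \<Rightarrow> 'm \<Rightarrow> 'm) \<Rightarrow> bool" where
  "wand_ax3 C w \<longleftrightarrow>
     (\<forall>X Y A. \<forall>f\<in>hom C X Y. \<forall>g\<in>hom C X A. \<forall>k\<in>hom C Y X.
        f \<perp>\<^bsub>C\<^esub> g \<longrightarrow>
        w (k \<Zcomp>\<^bsub>C\<^esub> f) (k \<Zcomp>\<^bsub>C\<^esub> g) = k \<Zcomp>\<^bsub>C\<^esub> w (f \<Zcomp>\<^bsub>C\<^esub> k) g)"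

definition wand_ax4 ::
    "('o, 'm, 'x) perp_data_scheme \<Rightarrow> ('m \<Rightarrow> 'm \<Rightarrow> 'm) \<Rightarrow> bool" where
  "wand_ax4 C w \<longleftrightarrow>
     (\<forall>X A. \<forall>f\<in>hom C X X. \<forall>f'\<in>hom C X X. \<forall>g\<in>hom C X A.
        f \<perp>\<^bsub>C\<^esub> f' \<and> (f \<squnion>\<^bsub>C\<^esub> f') \<perp>\<^bsub>C\<^esub> g \<longrightarrow>
        w f f' \<perp>\<^bsub>C\<^esub> w f g \<and> w (f \<squnion>\<^bsub>C\<^esub> f') g = w (w f f') (w f g))"

definition wand_ax4a ::
    "('o, 'm, 'x) perp_data_scheme \<Rightarrow> ('m \<Rightarrow> 'm \<Rightarrow> 'm) \<Rightarrow> bool" where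
  "wand_ax4a C w \<longleftrightarrow>
     (\<forall>X A. \<forall>f\<in>hom C X X. \<forall>f'\<in>hom C X X. \<forall>g\<in>hom C X A.
        f \<perp>\<^bsub>C\<^esub> f' \<and> f \<perp>\<^bsub>C\<^esub> g \<and> f' \<perp>\<^bsub>C\<^esub> g \<longrightarrow>
        w (f \<squnion>\<^bsub>C\<^esub> f') g = w (w f f') (w f g))"

locale kleene_wand = binary_perp_join_category C
  for C :: "('o, 'm, 'x) perp_data_scheme" (structure) +
  fixes w :: "'m \<Rightarrow> 'm \<Rightarrow> 'm"
  assumes wand_op: "wand_operator C w"
    and ax1: "wand_ax1 C w"
    and ax2: "wand_ax2 C w"
    and ax3: "wand_ax3 C w"
    and ax4: "wand_ax4 C w"

end

theory Submission
  imports Defs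
begin

text \<open>
  Everything rests on the fact that (2) makes \<open>f \<circledast> f'\<close> and \<open>f \<circledast> g\<close> disjoint when \<open>f\<close>, \<open>f'\<close>, \<open>g\<close>
  are pairwise disjoint. Although \<open>f'\<close> and \<open>g\<close> need not be parallel, their restrictions are; let
  \<open>e\<close> be the join of these. By strength \<open>f \<perp> e\<close>, and \<open>e f' = f'\<close>, \<open>e g = g\<close>. Hence (2) gives
  \<open>f \<circledast> f' = (f \<circledast> e) f'\<close> and \<open>f \<circledast> g = (f \<circledast> e) g\<close>, which are disjoint because \<open>f' \<perp> g\<close>.
  Strength and downward closure of \<open>\<perp>\<close> identify the hypotheses of (4) with those of (4.a).
\<close>

lemma (in category) homD:
  assumes "f \<in> hom C A B"
  shows "f \<in> arr C" "src C f = A" "tgt C f = B" "A \<in> obj C" "B \<in> obj C"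
  using assms src_obj[of f] tgt_obj[of f] by (auto simp: hom_def)

context restriction_category
begin

lemma rst_idm: "A \<in> obj C \<Longrightarrow> rst C (idm C A) = idm C A"
  by (metis idm_hom idm_right rst_cmp_self rst_hom)

text \<open>The case of \<open>rst_rst_cmp\<close> in which the second map is an identity, whose
  restriction is itself.\<close>

lemma rst_rst:
  assumes f: "f \<in> hom C A B"
  shows "rst C (rst C f) = rst C f"
proof -
  have A: "A \<in> obj C"
    using f by (rule homD)
  show ?thesis
    using rst_rst_cmp[OF idm_hom[OF A] f] by (simp add: rst_idm[OF A] idm_right[OF rst_hom[OF f]])
qed

lemma rle_hom_iff:
  "f \<in> hom C A B \<Longrightarrow> g \<in> hom C A B \<Longrightarrow> f \<sqsubseteq> g \<longleftrightarrow> rst C f \<Zcomp> g = f"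
  by (simp add: rle_def hom_def)

lemma rle_refl: "f \<in> hom C A B \<Longrightarrow> f \<sqsubseteq> f"
  by (simp add: rle_hom_iff rst_cmp_self)

text \<open>Commuting the two restrictions in \<open>rst C f \<Zcomp> rst C g \<Zcomp> f\<close>
  turns \<open>f\<close> into \<open>g\<close>.\<close>

lemma rle_antisym:
  assumes f: "f \<in> hom C A B" and g: "g \<in> hom C A B" and "f \<sqsubseteq> g" "g \<sqsubseteq> f"
  shows "f = g"
proof -
  have fg: "rst C f \<Zcomp> g = f" and gf: "rst C g \<Zcomp> f = g"
    using assms by (simp_all add: rle_hom_iff)
  have "f = rst C f \<Zcomp> (rst C g \<Zcomp> f)"
    using fg gf by simp
  also have "\<dots> = (rst C g \<Zcomp> rst C f) \<Zcomp> f"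
    using cmp_assoc[OF rst_hom[OF f] rst_hom[OF g] f] rst_commute[OF f g] by simp
  also have "\<dots> = g"
    using cmp_assoc[OF rst_hom[OF g] rst_hom[OF f] f] rst_cmp_self[OF f] gf by simp
  finally show ?thesis .
qed

lemma rst_rle_idm:
  assumes f: "f \<in> hom C A B"
  shows "rst C f \<sqsubseteq> idm C A"
proof -
  have "idm C A \<in> hom C A A"
    using f homD(4) idm_hom by blast
  then show ?thesis
    using rst_hom[OF f] by (simp add: rle_hom_iff rst_rst[OF f] idm_right)
qed

text \<open>A map below the identity is its own restriction, so \<open>e\<close> commutes with
  \<open>rst C f\<close>; since \<open>e\<close> lies above it, the product is
  \<open>rst C f\<close>, and \<open>rst C f\<close> fixes \<open>f\<close>.\<close>

lemma cmp_above_rst: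
  assumes f: "f \<in> hom C A B" and e: "e \<in> hom C A A"
    and le: "rst C f \<sqsubseteq> e" and le1: "e \<sqsubseteq> idm C A"
  shows "e \<Zcomp> f = f"
proof -
  have A: "idm C A \<in> hom C A A"
    using f homD(4) idm_hom by blast
  have rf: "rst C f \<in> hom C A A"
    using f by (rule rst_hom)
  have ee: "rst C e = e"
    using le1 e A idm_right[OF rst_hom[OF e]] by (simp add: rle_hom_iff)
  have "e \<Zcomp> rst C f = rst C f \<Zcomp> e"
    using rst_commute[OF e f] ee by simp
  also have "\<dots> = rst C f"
    using le e rf by (simp add: rle_hom_iff rst_rst[OF f])
  finally have "e \<Zcomp> rst C f = rst C f" .
  then show ?thesis
    using cmp_assoc[OF e rf f] rst_cmp_self[OF f] by simp
qed

end

context perp_restriction_category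
begin

lemma perp_family_pair:
  assumes "f \<in> hom C A B" "g \<in> hom C A B" "f \<perp> g"
  shows "perp_family C A B [f, g]"
  using assms homD(4,5)[of f A B] perp_sym[of f g]
  by (auto simp: perp_family_def less_Suc_eq)

lemma is_perp_join_unique:
  "is_perp_join C A B fs s \<Longrightarrow> is_perp_join C A B fs t \<Longrightarrow> s = t"
  unfolding is_perp_join_def by (meson rle_antisym)

lemma perp_rst_right:
  assumes "f \<perp> g" and f: "f \<in> hom C A B" and g: "g \<in> hom C A D"
  shows "f \<perp> rst C g"
proof -
  have A: "idm C A \<in> hom C A A"
    using f homD(4) idm_hom by blast
  have rf: "rst C f \<in> hom C A A" and rg: "rst C g \<in> hom C A A"
    using f g rst_hom by blast+
  \<comment> \<open>Disjointness survives different post-composites on the two sides: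
    \<open>f\<close> on the left rebuilds \<open>f\<close> from its restriction, the identity on the
    right leaves \<open>rst C g\<close> alone.\<close>
  have "idm C A \<Zcomp> rst C f \<Zcomp> f \<perp> idm C A \<Zcomp> rst C g \<Zcomp> idm C A"
    using perp_cmp[OF perp_rst[OF \<open>f \<perp> g\<close>] rf rg A f A] .
  then show ?thesis
    using idm_left[OF rf] idm_left[OF rg] idm_right[OF rg] rst_cmp_self[OF f] by simp
qed

end

context finitely_disjoint_category
begin

text \<open>Existence together with antisymmetry makes the definite description in
  \<open>perp_join\<close> denote.\<close>

lemma bjoin_is_perp_join:
  assumes f: "f \<in> hom C A B" and g: "g \<in> hom C A B" and "f \<perp> g"
  shows "is_perp_join C A B [f, g] (f \<squnion> g)"
proof -
  obtain s where s: "is_perp_join C A B [f, g] s"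
    using perp_join_exists perp_family_pair[OF assms] by blast
  then have "perp_join C A B [f, g] = s"
    unfolding perp_join_def by (blast intro: the_equality is_perp_join_unique)
  then show ?thesis
    using s homD[OF f] by (simp add: bjoin_def)
qed

lemma bjoin_hom:
  "f \<in> hom C A B \<Longrightarrow> g \<in> hom C A B \<Longrightarrow> f \<perp> g \<Longrightarrow> f \<squnion> g \<in> hom C A B"
  using bjoin_is_perp_join by (simp add: is_perp_join_def)

lemma bjoin_upper:
  assumes "f \<in> hom C A B" "g \<in> hom C A B" "f \<perp> g"
  shows "f \<sqsubseteq> f \<squnion> g" "g \<sqsubseteq> f \<squnion> g"
  using bjoin_is_perp_join[OF assms] by (simp_all add: is_perp_join_def)

lemma bjoin_least:
  "f \<in> hom C A B \<Longrightarrow> g \<in> hom C A B \<Longrightarrow> f \<perp> g \<Longrightarrow> u \<in> hom C A B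
    \<Longrightarrow> f \<sqsubseteq> u \<Longrightarrow> g \<sqsubseteq> u \<Longrightarrow> f \<squnion> g \<sqsubseteq> u"
  using bjoin_is_perp_join[of f A B g] by (simp add: is_perp_join_def)

text \<open>Left to right is downward closure of \<open>\<perp>\<close>, right to left is strength
  of the join.\<close>

lemma bjoin_perp_iff:
  assumes f: "f \<in> hom C A B" and g: "g \<in> hom C A B" and fg: "f \<perp> g" and h: "h \<in> hom C A D"
  shows "f \<squnion> g \<perp> h \<longleftrightarrow> f \<perp> h \<and> g \<perp> h"
proof
  assume "f \<squnion> g \<perp> h"
  then show "f \<perp> h \<and> g \<perp> h"
    using perp_down bjoin_upper[OF f g fg] rle_refl[OF h] by blast
next
  assume "f \<perp> h \<and> g \<perp> h"
  then show "f \<squnion> g \<perp> h"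
    using perp_join_strong[OF bjoin_is_perp_join[OF f g fg]] homD[OF h]
    by (simp add: strong_perp_join_def)
qed

lemma wand_perp_wand:
  assumes op: "wand_operator C w" and ax2: "wand_ax2 C w"
    and f: "f \<in> hom C X X" and f': "f' \<in> hom C X B" and g: "g \<in> hom C X A"
    and ff': "f \<perp> f'" and fg: "f \<perp> g" and f'g: "f' \<perp> g"
  shows "w f f' \<perp> w f g"
proof -
  define e where "e = rst C f' \<squnion> rst C g"
  have rf': "rst C f' \<in> hom C X X" and rg: "rst C g \<in> hom C X X"
    using f' g rst_hom by blast+
  have X: "idm C X \<in> hom C X X" and A: "idm C A \<in> hom C A A" and B: "idm C B \<in> hom C B B"
    using idm_hom homD[OF g] homD[OF f'] by simp_all
  note r = rf' rg perp_rst[OF f'g]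
  have e: "e \<in> hom C X X"
    unfolding e_def using r by (rule bjoin_hom)
  \<comment> \<open>The identity bounds both restrictions, hence also their join.\<close>
  have le1: "e \<sqsubseteq> idm C X"
    unfolding e_def using r X rst_rle_idm[OF f'] rst_rle_idm[OF g] by (rule bjoin_least)
  have ef': "e \<Zcomp> f' = f'"
    using f' e _ le1 by (rule cmp_above_rst) (simp add: e_def bjoin_upper[OF r])
  have eg: "e \<Zcomp> g = g"
    using g e _ le1 by (rule cmp_above_rst) (simp add: e_def bjoin_upper[OF r])
  have "e \<perp> f"
    unfolding e_def bjoin_perp_iff[OF r f]
    using perp_sym perp_rst_right[OF ff' f f'] perp_rst_right[OF fg f g] by blast
  then have fe: "f \<perp> e"
    by (rule perp_sym)
  have we: "w f e \<in> hom C X X"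
    using op f e fe by (simp add: wand_operator_def)
  have "w f e \<Zcomp> f' \<Zcomp> idm C B \<perp> w f e \<Zcomp> g \<Zcomp> idm C A"
    using f'g f' g we B A by (rule perp_cmp)
  then have "w f e \<Zcomp> f' \<perp> w f e \<Zcomp> g"
    using idm_right[OF cmp_hom[OF we f']] idm_right[OF cmp_hom[OF we g]] by simp
  moreover have "w f e \<Zcomp> f' = w f f'" "w f e \<Zcomp> g = w f g"
    \<comment> \<open>Axiom (2) moves the post-composite inside the wand, where \<open>e\<close> is
      absorbed.\<close>
    using ax2[unfolded wand_ax2_def, rule_format, OF f e _ fe] f' g ef' eg by simp_all
  ultimately show ?thesis
    by simp
qed

lemma wand_ax4_iff_ax4a:
  assumes "wand_operator C w" "wand_ax2 C w"
  shows "wand_ax4 C w \<longleftrightarrow> wand_ax4a C w"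
proof -
  have "f \<perp> f' \<and> f \<squnion> f' \<perp> g \<longleftrightarrow> f \<perp> f' \<and> f \<perp> g \<and> f' \<perp> g"
    if "f \<in> hom C X X" "f' \<in> hom C X X" "g \<in> hom C X A" for X A f f' g
    using bjoin_perp_iff[OF that(1,2) _ that(3)] by blast
  moreover have "w f f' \<perp> w f g"
    if "f \<in> hom C X X" "f' \<in> hom C X X" "g \<in> hom C X A" "f \<perp> f'" "f \<perp> g" "f' \<perp> g"
    for X A f f' g
    using wand_perp_wand[OF assms that] .
  ultimately show ?thesis
    by (simp add: wand_ax4_def wand_ax4a_def)
qed

lemma binary_perp_join_category: "binary_perp_join_category C"
  by unfold_locales (blast intro: bjoin_is_perp_join)

end

theorem lemma5p2:
  fixes C :: "('o, 'm, 'x) perp_data_scheme"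
    and w :: "'m \<Rightarrow> 'm \<Rightarrow> 'm"
  assumes "finitely_disjoint_category C"
    and "wand_operator C w"
  shows "(kleene_wand C w \<longleftrightarrow>
            wand_ax1 C w \<and> wand_ax2 C w \<and> wand_ax3 C w \<and> wand_ax4a C w)
       \<and> (wand_ax2 C w \<longrightarrow>
            (\<forall>X A. \<forall>f\<in>hom C X X. \<forall>f'\<in>hom C X X. \<forall>g\<in>hom C X A.
               f \<perp>\<^bsub>C\<^esub> f' \<and> f \<perp>\<^bsub>C\<^esub> g \<and> f' \<perp>\<^bsub>C\<^esub> g
               \<longrightarrow> w f f' \<perp>\<^bsub>C\<^esub> w f g))"
proof -
  interpret finitely_disjoint_category C
    by (rule assms(1))
  \<comment> \<open>The locale also demands binary joins and typing of \<open>w\<close>; both hold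
    here, so only the four axioms remain.\<close>
  have "kleene_wand C w \<longleftrightarrow>
      wand_ax1 C w \<and> wand_ax2 C w \<and> wand_ax3 C w \<and> wand_ax4 C w"
    using binary_perp_join_category assms(2)
    by (auto simp: kleene_wand_def kleene_wand_axioms_def)
  then show ?thesis
    using wand_ax4_iff_ax4a[OF assms(2)] wand_perp_wand[OF assms(2)] by blast
qed

end
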